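(* Let $T$ be the tree on the ten vertices $a,b,c,d,e,p,q,r,s,t$ with edge set $$\{\{a,b\},\{b,c\},\{c,d\},\{d,e\},\{e,p\},\{b,q\},\{c,r\},\{d,s\},\{e,t\}\}$$ (the path $a,b,c,d,e,p$ on six vertices with one pendant vertex attached to each of its four internal vertices). Then $T$, which is a tree of maximum degree $3$, is not $(2,3)$-orientable.
   Context: $\overrightarrow{uv}$ denotes an arc going from $u$ to $v$. A labeling $f:V\to\{0,1\}$ of a finite vertex set is friendly if it is surjective and $\big||f^{-1}(0)|-|f^{-1}(1)|\big|\le 1$. Given a digraph $D=(V,A)$ without directed $2$-cycles and a labeling $f:V\to\{0,1\}$, the induced arc labeling is $g:A\to\{-1,0,1\}$, $g(\overrightarrow{uv})=f(v)-f(u)$. $D$ is $(2,3)$-cordial if there is a friendly labeling $f$ of $V$ whose induced arc labeling $g$ satisfies $-1\le |g^{-1}(i)|-|g^{-1}(j)|\le 1$ for all $i,j\in\{-1,0,1\}$. An orientation of a simple undirected connected graph $G$ is a digraph on the same vertex set obtained by replacing each edge $\{u,v\}$ of $G$ by exactly one of the arcs $\overrightarrow{uv}$, $\overrightarrow{vu}$ (and having no other arcs). $G$ is $(2,3)$-orientable if there exists an orientation of $G$ that is $(2,3)$-cordial. *)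

theory Defs
  imports "Graph_Theory.Digraph_Component"
begin

text \<open>
  As in the Graph_Theory library, a finite simple undirected graph is a finite symmetric
  loop-free digraph without parallel arcs (locale \<^locale>\<open>pair_graph\<close>): an edge between
  \<open>u\<close> and \<open>v\<close> is represented by the two arcs \<open>(u, v)\<close> and \<open>(v, u)\<close>. Consequently
  \<^const>\<open>out_degree\<close> is the degree of a vertex in the undirected sense.
\<close>

definition ugraph :: "'a set \<Rightarrow> 'a set set \<Rightarrow> 'a pair_pre_digraph" where
  "ugraph V E = \<lparr> pverts = V, parcs = {(u, v). {u, v} \<in> E} \<rparr>"

text \<open>
  The library's \<open>tree\<close> forbids all directed cycles, in particular \<open>u, v, u\<close>, so it is
  not the undirected notion on symmetric digraphs. Undirected cycles are the directed ones
  with at least three arcs.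
\<close>

definition undirected_tree :: "'a pair_pre_digraph \<Rightarrow> bool" where
  "undirected_tree G \<longleftrightarrow>
     pair_graph G \<and> Digraph_Component.connected (with_proj G) \<and>
     \<not> (\<exists>p. pre_digraph.cycle (with_proj G) p \<and> 3 \<le> length p)"

definition max_degree :: "'a pair_pre_digraph \<Rightarrow> nat" where
  "max_degree G = Max (out_degree (with_proj G) ` pverts G)"

text \<open>Only the values of a labeling on the vertex set matter.\<close>

definition friendly :: "'a set \<Rightarrow> ('a \<Rightarrow> int) \<Rightarrow> bool" where
  "friendly V f \<longleftrightarrow>
     f ` V = {0, 1} \<and>
     \<bar>int (card {v \<in> V. f v = 0}) - int (card {v \<in> V. f v = 1})\<bar> \<le> 1"

definition arc_labeling :: "('a \<Rightarrow> int) \<Rightarrow> 'a \<times> 'a \<Rightarrow> int" where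
  "arc_labeling f = (\<lambda>(u, v). f v - f u)"

text \<open>
  Meant for digraphs without directed 2-cycles; see \<open>is_orientation_no_2_cycle\<close> below.
\<close>

definition cordial23 :: "'a pair_pre_digraph \<Rightarrow> bool" where
  "cordial23 D \<longleftrightarrow>
     (\<exists>f. friendly (pverts D) f \<and>
       (\<forall>i \<in> {-1, 0, 1}. \<forall>j \<in> {-1, 0, 1}.
          \<bar>int (card {e \<in> parcs D. arc_labeling f e = i})
           - int (card {e \<in> parcs D. arc_labeling f e = j})\<bar> \<le> 1))"

definition is_orientation :: "'a pair_pre_digraph \<Rightarrow> 'a pair_pre_digraph \<Rightarrow> bool" where
  "is_orientation D G \<longleftrightarrow>
     pverts D = pverts G \<and> parcs D \<subseteq> parcs G \<and>
     (\<forall>(u, v) \<in> parcs G. ((u, v) \<in> parcs D) \<noteq> ((v, u) \<in> parcs D))"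

lemma is_orientation_no_2_cycle:
  assumes "is_orientation D G" and "(u, v) \<in> parcs D"
  shows "(v, u) \<notin> parcs D"
  using assms unfolding is_orientation_def by blast

definition orientable23 :: "'a pair_pre_digraph \<Rightarrow> bool" where
  "orientable23 G \<longleftrightarrow> (\<exists>D. is_orientation D G \<and> cordial23 D)"

datatype vertex = Va | Vb | Vc | Vd | Ve | Vp | Vq | Vr | Vs | Vt

definition treeT :: "vertex pair_pre_digraph" where
  "treeT = ugraph {Va, Vb, Vc, Vd, Ve, Vp, Vq, Vr, Vs, Vt}
     {{Va, Vb}, {Vb, Vc}, {Vc, Vd}, {Vd, Ve}, {Ve, Vp},
      {Vb, Vq}, {Vc, Vr}, {Vd, Vs}, {Ve, Vt}}"

end

theory Submission
  imports Defs
begin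

text \<open>
  The obstruction is one of parity. For any orientation and any 0/1 labeling \<open>f\<close>, the sum of
  \<open>f u + f v\<close> over the arcs counts each vertex labeled 1 as often as its degree says; modulo 2 it is also
  the number of arcs with nonzero label. In the tree all degrees are odd (1 or 3), so the number
  of arcs with nonzero label has the parity of the number of vertices labeled 1
  (\<open>even_card_nonzero_arcs_iff\<close>). A friendly labeling of ten vertices has five vertices labeled
  1, whereas balancing nine arcs among three labels forces three arcs per label and hence six
  arcs with nonzero label. The argument works for every graph with odd degrees whose
  number of vertices is 2 modulo 4 and whose number of edges is divisible by 3
  (\<open>not_orientable23_if_odd_degrees\<close>).

  That the graph has no cycles is seen by peeling off leaves: a vertex of a cycle with at least
  three arcs has two neighbours on it (\<open>long_cycle_two_neighbours\<close>), so no leaf lies on such a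
  cycle, hence neither does a vertex that becomes a leaf when the leaves are removed, and so on.
\<close>

section \<open>Parity of the number of arcs with nonzero label\<close>

lemma parcs_eq_orientation_Un_swap:
  assumes "pair_graph G" and "is_orientation D G"
  shows "parcs G = parcs D \<union> prod.swap ` parcs D"
    and "parcs D \<inter> prod.swap ` parcs D = {}"
proof -
  interpret pair_graph G by fact
  have sym: "(v, u) \<in> parcs G" if "(u, v) \<in> parcs G" for u v
    using that pair_sym_arcs by (auto simp: symmetric_def dest: symD)
  show "parcs D \<inter> prod.swap ` parcs D = {}"
    using is_orientation_no_2_cycle[OF assms(2)] by auto
  show "parcs G = parcs D \<union> prod.swap ` parcs D"
  proof (rule set_eqI)
    fix e :: "'a \<times> 'a"
    obtain u v where e: "e = (u, v)" by (cases e)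
    have "(u, v) \<in> parcs G \<longleftrightarrow> (u, v) \<in> parcs D \<or> (v, u) \<in> parcs D"
      using assms(2) sym unfolding is_orientation_def by blast
    then show "e \<in> parcs G \<longleftrightarrow> e \<in> parcs D \<union> prod.swap ` parcs D"
      by (force simp: e image_iff)
  qed
qed

lemma card_parcs_orientation:
  assumes "pair_graph G" and "is_orientation D G"
  shows "card (parcs G) = 2 * card (parcs D)"
proof -
  interpret pair_graph G by fact
  note G = parcs_eq_orientation_Un_swap[OF assms]
  have fin: "finite (parcs D)" using pair_finite_arcs G(1) by simp
  have "card (prod.swap ` parcs D) = card (parcs D)"
    by (rule card_image) (rule inj_swap)
  then show ?thesis
    unfolding G(1) using fin G(2) by (simp add: card_Un_disjoint)
qed

text \<open>
  A weighted handshake identity: the head of an arc of \<open>D\<close> is the tail of the reversed arc, so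
  both sides are the sum of \<open>f\<close> over the tails of all arcs of \<open>G\<close>.
\<close>

lemma sum_orientation_ends:
  fixes f :: "'a \<Rightarrow> int"
  assumes "pair_graph G" and "is_orientation D G"
  shows "(\<Sum>e\<in>parcs D. f (fst e) + f (snd e))
           = (\<Sum>v\<in>pverts G. int (out_degree (with_proj G) v) * f v)"
proof -
  interpret pair_graph G by fact
  note G = parcs_eq_orientation_Un_swap[OF assms]
  have fin: "finite (parcs D)" using pair_finite_arcs G(1) by simp
  have "(\<Sum>e\<in>parcs D. f (fst e) + f (snd e))
      = (\<Sum>e\<in>parcs D. f (fst e)) + (\<Sum>e\<in>prod.swap ` parcs D. f (fst e))"
    by (simp add: sum.distrib sum.reindex)
  also have "\<dots> = (\<Sum>e\<in>parcs G. f (fst e))"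
    unfolding G(1) using fin G(2) by (simp add: sum.union_disjoint)
  also have "\<dots> = (\<Sum>v\<in>pverts G. \<Sum>e | e \<in> parcs G \<and> fst e = v. f (fst e))"
    by (rule sum.group[symmetric]) (auto simp: pair_finite_arcs pair_finite_verts dest: in_arcsD1)
  also have "\<dots> = (\<Sum>v\<in>pverts G. int (out_degree (with_proj G) v) * f v)"
    by (intro sum.cong refl) (simp add: out_degree_def out_arcs_def)
  finally show ?thesis .
qed

text \<open>Modulo 2, \<open>f u + f v\<close> and the arc label \<open>f v - f u\<close> agree.\<close>

lemma even_card_nonzero_arcs_iff:
  assumes "pair_graph G" and "is_orientation D G"
    and odd: "\<And>v. v \<in> pverts G \<Longrightarrow> odd (out_degree (with_proj G) v)"
    and f: "f ` pverts G \<subseteq> {0, 1}"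
  shows "even (card {e \<in> parcs D. arc_labeling f e \<noteq> 0})
           \<longleftrightarrow> even (card {v \<in> pverts G. f v = 1})"
proof -
  interpret pair_graph G by fact
  note G = parcs_eq_orientation_Un_swap(1)[OF assms(1,2)]
  have fin: "finite (parcs D)" using pair_finite_arcs G by simp
  have f01: "f v = 0 \<or> f v = 1" if "v \<in> pverts G" for v
    using f that by auto
  have "odd (f (fst e) + f (snd e)) \<longleftrightarrow> arc_labeling f e \<noteq> 0" if "e \<in> parcs D" for e
  proof -
    have "e \<in> parcs G" using that G by simp
    then show ?thesis
      using f01[of "fst e"] f01[of "snd e"] arc_fst_in_verts arc_snd_in_verts
      by (auto simp: arc_labeling_def split_beta)
  qed
  then have "{e \<in> parcs D. arc_labeling f e \<noteq> 0} = {e \<in> parcs D. odd (f (fst e) + f (snd e))}"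
    by blast
  moreover have "{v \<in> pverts G. f v = 1}
      = {v \<in> pverts G. odd (int (out_degree (with_proj G) v) * f v)}"
    using f01 odd by fastforce
  ultimately show ?thesis
    using sum_orientation_ends[OF assms(1,2), of f]
      even_sum_iff[OF fin, of "\<lambda>e. f (fst e) + f (snd e)"]
      even_sum_iff[OF pair_finite_verts, of "\<lambda>v. int (out_degree (with_proj G) v) * f v"]
    by simp
qed

lemma odd_part_if_balanced_halves:
  fixes a b :: nat
  assumes "(a + b) mod 4 = 2" and "\<bar>int a - int b\<bar> \<le> 1"
  shows "odd b"
proof -
  have "a = b \<or> a = Suc b \<or> b = Suc a" using assms(2) by linarith
  then show ?thesis using assms(1) by (elim disjE; hypsubst; presburger)
qed

lemma balanced_thirds_eq:
  fixes a b c :: nat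
  assumes dvd: "3 dvd a + (b + c)"
    and close: "\<bar>int a - int b\<bar> \<le> 1" "\<bar>int a - int c\<bar> \<le> 1" "\<bar>int b - int c\<bar> \<le> 1"
  shows "b = c"
proof (rule ccontr)
  assume "b \<noteq> c"
  then have "a + (b + c) = 3 * a + 1 \<or> a + (b + c) + 1 = 3 * a"
    using close by linarith
  then show False using dvd by presburger
qed

text \<open>
  Both divisibility conditions serve to pin down the two sides of the parity comparison: with
  \<open>4k + 2\<close> vertices a friendly labeling has the odd number \<open>2k + 1\<close> of ones, and with \<open>3m\<close> edges
  each of the three arc labels occurs exactly \<open>m\<close> times, so nonzero labels occur \<open>2m\<close> times.
  The modulus 6 appears because each edge is represented by two arcs.
\<close>

lemma not_orientable23_if_odd_degrees:
  assumes "pair_graph G"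
    and odd: "\<And>v. v \<in> pverts G \<Longrightarrow> odd (out_degree (with_proj G) v)"
    and verts: "card (pverts G) mod 4 = 2"
    and arcs: "6 dvd card (parcs G)"
  shows "\<not> orientable23 G"
proof
  interpret pair_graph G by fact
  assume "orientable23 G"
  then obtain D where D: "is_orientation D G" and "cordial23 D"
    by (auto simp: orientable23_def)
  then obtain f where "friendly (pverts D) f"
    and balanced: "\<forall>i \<in> {-1, 0, 1}. \<forall>j \<in> {-1, 0, 1}.
          \<bar>int (card {e \<in> parcs D. arc_labeling f e = i})
           - int (card {e \<in> parcs D. arc_labeling f e = j})\<bar> \<le> 1"
    unfolding cordial23_def by blast
  moreover have "pverts D = pverts G" using D by (simp add: is_orientation_def)
  ultimately have friendly: "friendly (pverts G) f" by simp
  have f: "f ` pverts G = {0, 1}" using friendly by (simp add: friendly_def)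
  have fin: "finite (parcs D)"
    using pair_finite_arcs parcs_eq_orientation_Un_swap(1)[OF assms(1) D] by simp
  let ?V = "\<lambda>i. {v \<in> pverts G. f v = i}"
  let ?A = "\<lambda>i. {e \<in> parcs D. arc_labeling f e = i}"

  have "pverts G = ?V 0 \<union> ?V 1" using f by auto
  moreover have "card (?V 0 \<union> ?V 1) = card (?V 0) + card (?V 1)"
    using pair_finite_verts by (intro card_Un_disjoint) auto
  ultimately have "card (pverts G) = card (?V 0) + card (?V 1)" by simp
  moreover have "\<bar>int (card (?V 0)) - int (card (?V 1))\<bar> \<le> 1"
    using friendly by (simp add: friendly_def)
  ultimately have ones: "odd (card (?V 1))"
    using verts odd_part_if_balanced_halves by simp

  have nz: "{e \<in> parcs D. arc_labeling f e \<noteq> 0} = ?A (-1) \<union> ?A 1"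
  proof -
    have "arc_labeling f e \<in> {-1, 0, 1}" if "e \<in> parcs D" for e
    proof -
      have "e \<in> parcs G"
        using that parcs_eq_orientation_Un_swap(1)[OF assms(1) D] by simp
      then have "f (fst e) \<in> {0, 1}" "f (snd e) \<in> {0, 1}"
        using f arc_fst_in_verts arc_snd_in_verts by auto
      then show ?thesis by (auto simp: arc_labeling_def split_beta)
    qed
    then show ?thesis by fastforce
  qed
  have card_nz: "card {e \<in> parcs D. arc_labeling f e \<noteq> 0} = card (?A (-1)) + card (?A 1)"
    unfolding nz using fin by (intro card_Un_disjoint) auto
  have "card (parcs D) = card (?A 0) + card {e \<in> parcs D. arc_labeling f e \<noteq> 0}"
  proof -
    have "parcs D = ?A 0 \<union> {e \<in> parcs D. arc_labeling f e \<noteq> 0}" by blast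
    moreover have "card (?A 0 \<union> {e \<in> parcs D. arc_labeling f e \<noteq> 0})
        = card (?A 0) + card {e \<in> parcs D. arc_labeling f e \<noteq> 0}"
      using fin by (intro card_Un_disjoint) auto
    ultimately show ?thesis by simp
  qed
  moreover have "3 dvd card (parcs D)"
    using arcs unfolding card_parcs_orientation[OF assms(1) D] by presburger
  ultimately have "3 dvd card (?A 0) + (card (?A (-1)) + card (?A 1))"
    using card_nz by simp
  moreover have "\<bar>int (card (?A 0)) - int (card (?A (-1)))\<bar> \<le> 1"
    "\<bar>int (card (?A 0)) - int (card (?A 1))\<bar> \<le> 1"
    "\<bar>int (card (?A (-1))) - int (card (?A 1))\<bar> \<le> 1"
    using balanced by simp_all
  ultimately have "card (?A (-1)) = card (?A 1)"
    by (intro balanced_thirds_eq)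
  then have "even (card {e \<in> parcs D. arc_labeling f e \<noteq> 0})"
    using card_nz by simp
  then show False
    using even_card_nonzero_arcs_iff[OF assms(1) D odd] f ones by blast
qed

section \<open>Cycles with at least three arcs\<close>

lemma pcas_imp_pawalk_verts: "pcas u p v \<Longrightarrow> pawalk_verts u p = u # map snd p"
  by (induction u p v rule: pcas.induct) auto

lemma pcas_fst_hd: "pcas u p v \<Longrightarrow> p \<noteq> [] \<Longrightarrow> fst (p ! 0) = u"
  by (cases p) auto

lemma pcas_snd_last: "pcas u p v \<Longrightarrow> p \<noteq> [] \<Longrightarrow> snd (p ! (length p - 1)) = v"
proof (induction u p v rule: pcas.induct)
  case (2 u e es v)
  then show ?case by (cases "es = []") (auto simp: nth_Cons')
qed simp

lemma pcas_fst_nth_Suc: "pcas u p v \<Longrightarrow> Suc i < length p \<Longrightarrow> fst (p ! Suc i) = snd (p ! i)"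
proof (induction p arbitrary: u i)
  case (Cons e p)
  then show ?case
    by (cases i; cases e; cases p) auto
qed simp

text \<open>
  The two neighbours are the predecessor and the successor on the cycle; they differ because
  their positions do, which for a cycle with two arcs fails.
\<close>

lemma long_cycle_two_neighbours:
  assumes cycle: "pre_digraph.cycle (with_proj G) p" and len: "3 \<le> length p"
    and x: "x \<in> snd ` set p"
  obtains y z where "y \<in> snd ` set p" "z \<in> snd ` set p" "y \<noteq> z"
    "(y, x) \<in> parcs G" "(x, z) \<in> parcs G"
proof -
  obtain u where "pre_digraph.awalk (with_proj G) u p u"
    and dist: "distinct (tl (pre_digraph.awalk_verts (with_proj G) u p))" and ne: "p \<noteq> []"
    using cycle by (auto simp: pre_digraph.cycle_def)
  then have arcs: "set p \<subseteq> parcs G" and cas: "pcas u p u"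
    by (auto simp: pre_digraph.awalk_def cas_with_proj_eq)
  have dist: "distinct (map snd p)"
    using dist pcas_imp_pawalk_verts[OF cas] by (simp add: awalk_verts_with_proj_eq)
  obtain i where i: "i < length p" "x = snd (p ! i)"
    using x by (auto simp: in_set_conv_nth)
  define j where "j = (if Suc i < length p then Suc i else 0)"
  define k where "k = (if i = 0 then length p - 1 else i - 1)"
  have jk: "j < length p" "k < length p" "k \<noteq> j"
    using i len by (auto simp: j_def k_def)
  have "fst (p ! j) = x"
  proof (cases "Suc i < length p")
    case True
    then show ?thesis using pcas_fst_nth_Suc[OF cas] i by (simp add: j_def)
  next
    case False
    then have "i = length p - 1" using i by simp
    then show ?thesis
      using False pcas_fst_hd[OF cas ne] pcas_snd_last[OF cas ne] i by (simp add: j_def)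
  qed
  moreover have "fst (p ! i) = snd (p ! k)"
  proof (cases i)
    case 0
    then show ?thesis
      using pcas_fst_hd[OF cas ne] pcas_snd_last[OF cas ne] by (simp add: k_def)
  next
    case (Suc i')
    then show ?thesis using pcas_fst_nth_Suc[OF cas] i by (simp add: k_def)
  qed
  moreover have "p ! i \<in> parcs G" "p ! j \<in> parcs G"
    using arcs i jk by auto
  ultimately have "(snd (p ! k), x) \<in> parcs G" "(x, snd (p ! j)) \<in> parcs G"
    using i by (metis prod.collapse)+
  moreover have "snd (p ! k) \<noteq> snd (p ! j)"
    using dist jk by (simp add: distinct_conv_nth)
  moreover have "snd (p ! k) \<in> snd ` set p" "snd (p ! j) \<in> snd ` set p"
    using jk by simp_all
  ultimately show thesis
    using that by blast
qed

section \<open>The tree\<close>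

lemma pverts_treeT: "pverts treeT = {Va, Vb, Vc, Vd, Ve, Vp, Vq, Vr, Vs, Vt}"
  by (simp add: treeT_def ugraph_def)

lemma parcs_treeT:
  "parcs treeT =
     {(Va, Vb), (Vb, Vc), (Vc, Vd), (Vd, Ve), (Ve, Vp), (Vb, Vq), (Vc, Vr), (Vd, Vs), (Ve, Vt),
      (Vb, Va), (Vc, Vb), (Vd, Vc), (Ve, Vd), (Vp, Ve), (Vq, Vb), (Vr, Vc), (Vs, Vd), (Vt, Ve)}"
  by (auto simp: treeT_def ugraph_def doubleton_eq_iff)

lemma sym_parcs_ugraph: "sym (parcs (ugraph V E))"
  by (simp add: ugraph_def sym_def insert_commute)

lemma pair_graph_treeT: "pair_graph treeT"
proof
  fix e assume "e \<in> parcs treeT"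
  then show "fst e \<in> pverts treeT" "snd e \<in> pverts treeT" "fst e \<noteq> snd e"
    unfolding parcs_treeT pverts_treeT by auto
next
  show "finite (pverts treeT)" "finite (parcs treeT)"
    by (simp_all add: pverts_treeT parcs_treeT)
  show "symmetric (with_proj treeT)"
    unfolding symmetric_def with_proj_simps treeT_def by (rule sym_parcs_ugraph)
qed

lemma connected_treeT: "Digraph_Component.connected (with_proj treeT)"
proof -
  interpret pair_graph treeT by (rule pair_graph_treeT)
  let ?R = "\<lambda>u v. u \<rightarrow>\<^sup>*\<^bsub>with_proj treeT\<^esub> v"
  have adj: "?R u v" if "(u, v) \<in> parcs treeT" for u v
    using that by (intro reachable_adjI) simp
  have bc: "?R Vb Vc" and dc: "?R Vd Vc" and ed: "?R Ve Vd"
    by (rule adj, simp add: parcs_treeT)+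
  have ec: "?R Ve Vc" by (rule reachable_trans[OF ed dc])
  have to_c: "?R v Vc" if "v \<in> pverts treeT" for v
  proof -
    have "?R Va Vb" "?R Vq Vb" "?R Vr Vc" "?R Vs Vd" "?R Vt Ve" "?R Vp Ve"
      by (rule adj, simp add: parcs_treeT)+
    moreover have "?R Vc Vc" by (simp add: pverts_treeT)
    ultimately show ?thesis
      using that bc dc ec
      by (cases v) (simp_all, (erule (1) reachable_trans)+)
  qed
  have "symmetric (with_proj treeT)" by (rule pair_sym_arcs)
  then have "?R u v" if "u \<in> pverts treeT" "v \<in> pverts treeT" for u v
    using that by (metis to_c symmetric_reachable reachable_trans)
  then show ?thesis
    using reachable_mk_symmetricI
    by (auto simp: connected_def strongly_connected_def pverts_treeT)
qed

lemma treeT_no_long_cycle: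
  assumes "pre_digraph.cycle (with_proj treeT) p" and "3 \<le> length p"
  shows False
proof -
  define S where "S = snd ` set p"
  have two: "\<exists>y z. y \<in> S \<and> z \<in> S \<and> y \<noteq> z \<and> (y, x) \<in> parcs treeT \<and> (x, z) \<in> parcs treeT"
    if "x \<in> S" for x
    using long_cycle_two_neighbours[OF assms] that unfolding S_def by metis
  have leaves: "Va \<notin> S" "Vp \<notin> S" "Vq \<notin> S" "Vr \<notin> S" "Vs \<notin> S" "Vt \<notin> S"
    using two[of Va] two[of Vp] two[of Vq] two[of Vr] two[of Vs] two[of Vt]
    by (auto simp: parcs_treeT)
  have b: "Vb \<notin> S"
    using two[of Vb] leaves by (auto simp: parcs_treeT)
  have c: "Vc \<notin> S"
    using two[of Vc] leaves b by (auto simp: parcs_treeT)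
  have d: "Vd \<notin> S"
    using two[of Vd] leaves c by (auto simp: parcs_treeT)
  have e: "Ve \<notin> S"
    using two[of Ve] leaves d by (auto simp: parcs_treeT)
  have "v \<notin> S" for v
    using leaves b c d e by (cases v) simp_all
  then show False using assms(2) by (cases p) (auto simp: S_def)
qed

lemma out_degree_treeT:
  "out_degree (with_proj treeT) v = (if v \<in> {Vb, Vc, Vd, Ve} then 3 else 1)"
proof -
  have "out_arcs (with_proj treeT) v =
      (case v of Va \<Rightarrow> {(Va, Vb)} | Vp \<Rightarrow> {(Vp, Ve)} | Vq \<Rightarrow> {(Vq, Vb)}
       | Vr \<Rightarrow> {(Vr, Vc)} | Vs \<Rightarrow> {(Vs, Vd)} | Vt \<Rightarrow> {(Vt, Ve)}
       | Vb \<Rightarrow> {(Vb, Va), (Vb, Vc), (Vb, Vq)} | Vc \<Rightarrow> {(Vc, Vb), (Vc, Vd), (Vc, Vr)}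
       | Vd \<Rightarrow> {(Vd, Vc), (Vd, Ve), (Vd, Vs)} | Ve \<Rightarrow> {(Ve, Vd), (Ve, Vp), (Ve, Vt)})"
    by (cases v) (auto simp: out_arcs_def parcs_treeT)
  then show ?thesis
    by (cases v) (simp_all add: out_degree_def)
qed

theorem mainTheorem2:
  shows "undirected_tree treeT \<and> max_degree treeT = 3 \<and> \<not> orientable23 treeT"
proof (intro conjI)
  show "undirected_tree treeT"
    unfolding undirected_tree_def
    using pair_graph_treeT connected_treeT treeT_no_long_cycle by blast
  have "out_degree (with_proj treeT) ` pverts treeT = {1, 3}"
    by (auto simp: out_degree_treeT pverts_treeT)
  then show "max_degree treeT = 3"
    by (simp add: max_degree_def)
  show "\<not> orientable23 treeT"
  proof (rule not_orientable23_if_odd_degrees[OF pair_graph_treeT])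
    show "odd (out_degree (with_proj treeT) v)" for v
      by (simp add: out_degree_treeT)
    show "card (pverts treeT) mod 4 = 2" by (simp add: pverts_treeT)
    have "card (parcs treeT) = 18" by (simp add: parcs_treeT)
    then show "6 dvd card (parcs treeT)" by simp
  qed
qed

end
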